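(* Let $n\geq 2$, let $\{\lambda_{n;m}\}_{m=1}^{n}$ and $\{\mu_m\}_{m=1}^{n}$ be nonincreasing sequences of real numbers, and suppose $\{\lambda_{n;m}\}_{m=1}^{n} \succeq \{\mu_{m}\}_{m=1}^{n}$. Let $\{\lambda_{n-1;m}\}_{m=1}^{n-1}$ be a sequence of real numbers. Then $\{\lambda_{n-1;m}\}_{m=1}^{n-1} \succeq \{\mu_{m}\}_{m=1}^{n-1}$ and $\{\lambda_{n-1;m}\}_{m=1}^{n-1}\sqsubseteq\{\lambda_{n;m}\}_{m=1}^{n}$ if and only if $\lambda_{n-1;k}\in[A_{n-1;k},B_{n-1;k}]$ for every $k=1,\ldots,n-1$, where $$A_{n-1;k}:=\max \bigg\{ \lambda_{n;k+1},\ \sum_{m=k}^{n} \lambda_{n;m} - \sum_{m=k+1}^{n-1} \lambda_{n-1;m} - \mu_n \bigg\},$$ $$B_{n-1;k}:=\min \bigg\{ \lambda_{n;k},\ \min_{l=1,\dots,k} \bigg\{\sum_{m=l}^{n-1} \mu_m - \sum_{m=l+1}^{k} \lambda_{n;m} - \sum_{m=k+1}^{n-1} \lambda_{n-1;m} \bigg\}\bigg\}.$$ Here, the convention is that sums over empty sets of indices are zero. Moreover, let $k\in\{1,\dots,n-1\}$ and suppose $\lambda_{n-1;n-1},\dots,\lambda_{n-1;k+1}$ are consecutively chosen (in this order) to satisfy these bounds, i.e., $\lambda_{n-1;j}\in[A_{n-1;j},B_{n-1;j}]$ for $j=n-1,\dots,k+1$. Then $A_{n-1;k}\leq B_{n-1;k}$,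 and so $\lambda_{n-1;k}$ can also be chosen from such an interval.
   Context: Majorization: for nonincreasing real sequences $\{\lambda_m\}_{m=1}^n$ and $\{\mu_m\}_{m=1}^n$, one writes $\{\lambda_m\}_{m=1}^n\succeq\{\mu_m\}_{m=1}^n$ if $\sum_{m=1}^j\lambda_m\geq\sum_{m=1}^j\mu_m$ for all $j=1,\dots,n-1$ and $\sum_{m=1}^n\lambda_m=\sum_{m=1}^n\mu_m$. Interlacing: one writes $\{\alpha_m\}_{m=1}^{n-1}\sqsubseteq\{\beta_m\}_{m=1}^{n}$ if $\beta_{m+1}\leq\alpha_m\leq\beta_m$ for all $m=1,\ldots,n-1$. Note that $A_{n-1;k}$ and $B_{n-1;k}$ depend on $\{\lambda_{n;m}\}_{m=1}^n$, $\{\mu_m\}_{m=1}^n$ and only on those $\lambda_{n-1;m}$ with $m>k$. *)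

theory Defs
  imports Complex_Main
begin

text \<open>
  A finite real sequence with terms indexed by \<open>1, \<dots>, n\<close> is a function \<open>nat \<Rightarrow> real\<close>
  together with its length \<open>n\<close>; values at indices outside \<open>{1..n}\<close> are irrelevant.
\<close>

text \<open>The relation is only defined between nonincreasing sequences, so this is part of the predicate.\<close>

definition majorizes :: "nat \<Rightarrow> (nat \<Rightarrow> real) \<Rightarrow> (nat \<Rightarrow> real) \<Rightarrow> bool" where
  "majorizes n a b \<longleftrightarrow>
     antimono_on {1..n} a \<and> antimono_on {1..n} b \<and>
     (\<forall>j\<in>{1..n-1}. (\<Sum>m=1..j. a m) \<ge> (\<Sum>m=1..j. b m)) \<and>
     (\<Sum>m=1..n. a m) = (\<Sum>m=1..n. b m)"

text \<open>Here \<open>n\<close> is the length of the longer sequence \<open>b\<close>; the sequence \<open>a\<close> has length \<open>n - 1\<close>.\<close>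

definition interlaces :: "nat \<Rightarrow> (nat \<Rightarrow> real) \<Rightarrow> (nat \<Rightarrow> real) \<Rightarrow> bool" where
  "interlaces n a b \<longleftrightarrow> (\<forall>m\<in>{1..n-1}. b (m + 1) \<le> a m \<and> a m \<le> b m)"

text \<open>
  In the bounds, \<open>lam m\<close> stands for \<open>\<lambda>\<^bsub>n;m\<^esub>\<close> and \<open>nu m\<close> for \<open>\<lambda>\<^bsub>n-1;m\<^esub>\<close>.
  Only the values \<open>nu m\<close> with \<open>m > k\<close> occur.
\<close>

definition lower_bd :: "nat \<Rightarrow> (nat \<Rightarrow> real) \<Rightarrow> (nat \<Rightarrow> real) \<Rightarrow> (nat \<Rightarrow> real) \<Rightarrow> nat \<Rightarrow> real" where
  "lower_bd n lam mu nu k =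
     max (lam (k + 1)) ((\<Sum>m=k..n. lam m) - (\<Sum>m=k+1..n-1. nu m) - mu n)"

definition upper_bd :: "nat \<Rightarrow> (nat \<Rightarrow> real) \<Rightarrow> (nat \<Rightarrow> real) \<Rightarrow> (nat \<Rightarrow> real) \<Rightarrow> nat \<Rightarrow> real" where
  "upper_bd n lam mu nu k =
     min (lam k)
       (MIN l\<in>{1..k}. (\<Sum>m=l..n-1. mu m) - (\<Sum>m=l+1..k. lam m) - (\<Sum>m=k+1..n-1. nu m))"

end

theory Submission
  imports Defs
begin

text \<open>
  Everything is governed by the tail sums \<open>T k = (\<Sum>m=k..n-1. nu m)\<close>. Moving the tail beyond \<open>k\<close>
  to the other side turns the condition that \<open>nu k\<close> lies between its two bounds into the
  interlacing inequalities \<open>lam (k+1) \<le> nu k \<le> lam k\<close> together with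
  \<open>(\<Sum>m=k..n. lam m) - mu n \<le> T k\<close> and
  \<open>T k + (\<Sum>m=l+1..k. lam m) \<le> (\<Sum>m=l..n-1. mu m)\<close> for all \<open>l \<le> k\<close>.

  If \<open>nu\<close> interlaces \<open>lam\<close> and majorizes \<open>mu\<close>, then \<open>T l \<le> (\<Sum>m=l..n-1. mu m)\<close>, with equality at
  \<open>l = 1\<close>. Bounding \<open>nu m \<le> lam m\<close> for \<open>m < k\<close> in \<open>T 1\<close> gives the lower estimate on \<open>T k\<close>;
  bounding \<open>nu m \<ge> lam (m+1)\<close> for \<open>l \<le> m < k\<close> in \<open>T l\<close> gives the upper estimates. Conversely, the
  upper estimates with \<open>l = k\<close> are the majorization inequalities in tail form, and at \<open>k = 1\<close> the
  lower and the upper estimate together pin the total \<open>T 1\<close> to \<open>(\<Sum>m=1..n-1. mu m)\<close>.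

  That the interval for \<open>nu k\<close> is nonempty amounts to comparing each of the two terms of the
  maximum with each term of the minimum. The two comparisons that involve \<open>T (k+1)\<close> are exactly
  the tail estimates already known at \<open>k+1\<close>, or, when \<open>k = n-1\<close> and the tail is empty, follow
  from \<open>lam\<close> majorizing \<open>mu\<close>. The other two follow from monotonicity of \<open>lam\<close> and from the tail
  form of the majorization of \<open>mu\<close> by \<open>lam\<close>.
\<close>

lemma sum_split_at:
  fixes f :: "nat \<Rightarrow> 'a::comm_monoid_add"
  assumes "l \<le> k + 1" "k \<le> n"
  shows "(\<Sum>m=l..n. f m) = (\<Sum>m=l..k. f m) + (\<Sum>m=k+1..n. f m)"
  using sum.ub_add_nat[of l k f "n - k"] assms by simp

lemma sum_split_first:
  fixes f :: "nat \<Rightarrow> 'a::comm_monoid_add"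
  assumes "k \<le> n"
  shows "(\<Sum>m=k..n. f m) = f k + (\<Sum>m=k+1..n. f m)"
  using sum.atLeast_Suc_atMost[of k n f] assms by simp

lemma sum_split_last:
  fixes f :: "nat \<Rightarrow> 'a::comm_monoid_add"
  assumes "1 \<le> n" "l \<le> n"
  shows "(\<Sum>m=l..n. f m) = (\<Sum>m=l..n-1. f m) + f n"
  using sum_split_at[of l "n - 1" n f] assms by simp

text \<open>
  Since the totals agree, the inequalities between initial sums reverse for tails. The bounds
  involve tails of \<open>nu\<close>, so this is the form in which majorization can be compared with them.
\<close>

lemma majorizes_iff_tail_sums:
  "majorizes n a b \<longleftrightarrow>
     antimono_on {1..n} a \<and> antimono_on {1..n} b \<and>
     (\<forall>l\<in>{1..n}. (\<Sum>m=l..n. a m) \<le> (\<Sum>m=l..n. b m)) \<and>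
     (\<Sum>m=1..n. a m) = (\<Sum>m=1..n. b m)"
proof (cases "(\<Sum>m=1..n. a m) = (\<Sum>m=1..n. b m)")
  case total: True
  have step: "(\<Sum>m=1..j. b m) \<le> (\<Sum>m=1..j. a m) \<longleftrightarrow>
                (\<Sum>m=j+1..n. a m) \<le> (\<Sum>m=j+1..n. b m)" if "j \<le> n" for j
    using total sum_split_at[of 1 j n a] sum_split_at[of 1 j n b] that by linarith
  have "(\<forall>j\<in>{1..n-1}. (\<Sum>m=1..j. b m) \<le> (\<Sum>m=1..j. a m)) \<longleftrightarrow>
          (\<forall>l\<in>{1..n}. (\<Sum>m=l..n. a m) \<le> (\<Sum>m=l..n. b m))" (is "?L \<longleftrightarrow> ?R")
  proof
    assume L: ?L
    show ?R
    proof
      fix l assume l: "l \<in> {1..n}"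
      show "(\<Sum>m=l..n. a m) \<le> (\<Sum>m=l..n. b m)"
      proof (cases "l = 1")
        case True
        with total show ?thesis by simp
      next
        case False
        with l have "l - 1 \<in> {1..n-1}" by auto
        with L step[of "l - 1"] l show ?thesis by fastforce
      qed
    qed
  next
    assume R: ?R
    show ?L
    proof
      fix j assume "j \<in> {1..n-1}"
      then have "j \<le> n" "j + 1 \<in> {1..n}" by auto
      with R step show "(\<Sum>m=1..j. b m) \<le> (\<Sum>m=1..j. a m)" by blast
    qed
  qed
  then show ?thesis unfolding majorizes_def by blast
qed (auto simp: majorizes_def)

lemma lower_bd_le_iff:
  "lower_bd n lam mu nu k \<le> x \<longleftrightarrow>
     lam (k + 1) \<le> x \<and> (\<Sum>m=k..n. lam m) - mu n \<le> x + (\<Sum>m=k+1..n-1. nu m)"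
  unfolding lower_bd_def by auto

lemma le_upper_bd_iff:
  assumes "1 \<le> k"
  shows "x \<le> upper_bd n lam mu nu k \<longleftrightarrow>
     x \<le> lam k \<and>
     (\<forall>l\<in>{1..k}. x + (\<Sum>m=k+1..n-1. nu m) + (\<Sum>m=l+1..k. lam m) \<le> (\<Sum>m=l..n-1. mu m))"
proof -
  have "x \<le> (MIN l\<in>{1..k}. (\<Sum>m=l..n-1. mu m) - (\<Sum>m=l+1..k. lam m) - (\<Sum>m=k+1..n-1. nu m)) \<longleftrightarrow>
        (\<forall>l\<in>{1..k}. x \<le> (\<Sum>m=l..n-1. mu m) - (\<Sum>m=l+1..k. lam m) - (\<Sum>m=k+1..n-1. nu m))"
    using assms by (subst Min_ge_iff) auto
  also have "\<dots> \<longleftrightarrow>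
      (\<forall>l\<in>{1..k}. x + (\<Sum>m=k+1..n-1. nu m) + (\<Sum>m=l+1..k. lam m) \<le> (\<Sum>m=l..n-1. mu m))"
    by (intro ball_cong refl) linarith
  finally show ?thesis
    unfolding upper_bd_def by simp
qed

lemma mem_bounds_iff:
  assumes "k \<in> {1..n-1}"
  shows "nu k \<in> {lower_bd n lam mu nu k..upper_bd n lam mu nu k} \<longleftrightarrow>
     lam (k + 1) \<le> nu k \<and> nu k \<le> lam k \<and>
     (\<Sum>m=k..n. lam m) - mu n \<le> (\<Sum>m=k..n-1. nu m) \<and>
     (\<forall>l\<in>{1..k}. (\<Sum>m=k..n-1. nu m) + (\<Sum>m=l+1..k. lam m) \<le> (\<Sum>m=l..n-1. mu m))"
proof -
  have "1 \<le> k" "(\<Sum>m=k..n-1. nu m) = nu k + (\<Sum>m=k+1..n-1. nu m)"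
    using assms sum_split_first[of k "n - 1" nu] by auto
  then show ?thesis
    unfolding atLeastAtMost_iff lower_bd_le_iff le_upper_bd_iff[OF \<open>1 \<le> k\<close>] by auto
qed

lemma bounds_cong:
  assumes "\<And>m. m \<in> {k+1..n-1} \<Longrightarrow> nu m = nu' m"
  shows "lower_bd n lam mu nu k = lower_bd n lam mu nu' k"
    and "upper_bd n lam mu nu k = upper_bd n lam mu nu' k"
proof -
  have "(\<Sum>m=k+1..n-1. nu m) = (\<Sum>m=k+1..n-1. nu' m)"
    using assms by (rule sum.cong[OF refl])
  then show "lower_bd n lam mu nu k = lower_bd n lam mu nu' k"
    and "upper_bd n lam mu nu k = upper_bd n lam mu nu' k"
    unfolding lower_bd_def upper_bd_def by simp_all
qed

lemma interlaces_imp_antimono_on: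
  assumes "interlaces n a b"
  shows "antimono_on {1..n-1} a"
proof (rule monotone_onI)
  fix i j assume i: "i \<in> {1..n-1}" and j: "j \<in> {1..n-1}" and "i \<le> j"
  \<comment> \<open>Consecutive entries of \<open>a\<close> are separated by an entry of \<open>b\<close>.\<close>
  have consecutive: "a (Suc m) \<le> a m" if "m \<in> {1..n-1}" "Suc m \<in> {1..n-1}" for m
  proof -
    have "a (Suc m) \<le> b (Suc m)" "b (Suc m) \<le> a m"
      using assms that unfolding interlaces_def by auto
    then show ?thesis by (rule order_trans)
  qed
  from \<open>i \<le> j\<close> j show "a j \<le> a i"
  proof (induction j rule: dec_induct)
    case (step m)
    have "m \<in> {1..n-1}" using i step by auto
    with step consecutive[of m] show ?case by simp
  qed simp
qed

lemma majorizes_interlaces_imp_mem_bounds: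
  assumes total: "(\<Sum>m=1..n. lam m) = (\<Sum>m=1..n. mu m)"
    and maj: "majorizes (n - 1) nu mu" and inter: "interlaces n nu lam"
    and k: "k \<in> {1..n-1}"
  shows "nu k \<in> {lower_bd n lam mu nu k..upper_bd n lam mu nu k}"
proof -
  have tails: "(\<Sum>m=l..n-1. nu m) \<le> (\<Sum>m=l..n-1. mu m)" if "l \<in> {1..n-1}" for l
    using maj that unfolding majorizes_iff_tail_sums by blast
  have total': "(\<Sum>m=1..n-1. nu m) = (\<Sum>m=1..n-1. mu m)"
    using maj unfolding majorizes_def by blast
  have split: "(\<Sum>m=l..n-1. nu m) = (\<Sum>m=l..k-1. nu m) + (\<Sum>m=k..n-1. nu m)" if "l \<in> {1..k}" for l
    using sum_split_at[of l "k - 1" "n - 1" nu] that k by simp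

  have "(\<Sum>m=k..n. lam m) - mu n \<le> (\<Sum>m=k..n-1. nu m)"
  proof -
    have "(\<Sum>m=1..k-1. nu m) \<le> (\<Sum>m=1..k-1. lam m)"
      using inter k unfolding interlaces_def by (intro sum_mono) auto
    moreover have "(\<Sum>m=1..n. mu m) = (\<Sum>m=1..n-1. mu m) + mu n"
      using sum_split_last[of n 1 mu] k by auto
    moreover have "(\<Sum>m=1..n. lam m) = (\<Sum>m=1..k-1. lam m) + (\<Sum>m=k..n. lam m)"
      using sum_split_at[of 1 "k - 1" n lam] k by auto
    ultimately show ?thesis
      using total total' split[of 1] k by auto
  qed
  moreover have "(\<Sum>m=k..n-1. nu m) + (\<Sum>m=l+1..k. lam m) \<le> (\<Sum>m=l..n-1. mu m)"
    if l: "l \<in> {1..k}" for l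
  proof -
    have "(\<Sum>m=l+1..k. lam m) = (\<Sum>m=l..k-1. lam (m + 1))"
      using sum.shift_bounds_cl_nat_ivl[of lam l 1 "k - 1"] k
      by (simp del: sum.cl_ivl_Suc)
    also have "\<dots> \<le> (\<Sum>m=l..k-1. nu m)"
      using inter k l unfolding interlaces_def by (intro sum_mono) auto
    finally show ?thesis
      using split[OF l] tails[of l] l k by auto
  qed
  ultimately show ?thesis
    using inter k unfolding mem_bounds_iff[OF k] interlaces_def by blast
qed

lemma mem_bounds_imp_majorizes_interlaces:
  assumes "n \<ge> 2" and mu: "antimono_on {1..n} mu"
    and total: "(\<Sum>m=1..n. lam m) = (\<Sum>m=1..n. mu m)"
    and bounds: "\<And>k. k \<in> {1..n-1} \<Longrightarrow> nu k \<in> {lower_bd n lam mu nu k..upper_bd n lam mu nu k}"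
  shows "majorizes (n - 1) nu mu \<and> interlaces n nu lam"
proof
  show inter: "interlaces n nu lam"
    using bounds mem_bounds_iff unfolding interlaces_def by blast
  have tails: "(\<Sum>m=k..n-1. nu m) \<le> (\<Sum>m=k..n-1. mu m)" if k: "k \<in> {1..n-1}" for k
  proof -
    have "k \<in> {1..k}" using k by simp
    then have "(\<Sum>m=k..n-1. nu m) + (\<Sum>m=k+1..k. lam m) \<le> (\<Sum>m=k..n-1. mu m)"
      using bounds[OF k] unfolding mem_bounds_iff[OF k] by blast
    then show ?thesis by simp
  qed
  moreover have "(\<Sum>m=1..n-1. nu m) = (\<Sum>m=1..n-1. mu m)"
  proof (rule antisym)
    have one: "1 \<in> {1..n-1}" using \<open>n \<ge> 2\<close> by simp
    from tails[OF one] show "(\<Sum>m=1..n-1. nu m) \<le> (\<Sum>m=1..n-1. mu m)" .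
    have "(\<Sum>m=1..n. lam m) - mu n \<le> (\<Sum>m=1..n-1. nu m)"
      using bounds[OF one] unfolding mem_bounds_iff[OF one] by blast
    moreover have "(\<Sum>m=1..n. mu m) = (\<Sum>m=1..n-1. mu m) + mu n"
      using sum_split_last[of n 1 mu] \<open>n \<ge> 2\<close> by simp
    ultimately show "(\<Sum>m=1..n-1. mu m) \<le> (\<Sum>m=1..n-1. nu m)"
      using total by linarith
  qed
  moreover have "antimono_on {1..n-1} mu"
    using mu by (rule monotone_on_subset) auto
  ultimately show "majorizes (n - 1) nu mu"
    using interlaces_imp_antimono_on[OF inter] unfolding majorizes_iff_tail_sums by blast
qed

text \<open>
  The bounds at \<open>k + 1\<close> already control the whole tail sum \<open>(\<Sum>m=k+1..n-1. nu m)\<close> of the entries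
  chosen so far, so earlier choices enter only through them. At \<open>k = n - 1\<close> there is no such entry, and the same
  two estimates on the empty tail become \<open>lam n \<le> mu n\<close> and
  \<open>(\<Sum>m=l+1..n. lam m) \<le> (\<Sum>m=l+1..n. mu m) \<le> (\<Sum>m=l..n-1. mu m)\<close>.
\<close>

lemma lower_bd_le_upper_bd:
  assumes maj: "majorizes n lam mu" and k: "k \<in> {1..n-1}"
    and bounds: "k + 1 \<le> n - 1 \<Longrightarrow>
      nu (k + 1) \<in> {lower_bd n lam mu nu (k + 1)..upper_bd n lam mu nu (k + 1)}"
  shows "lower_bd n lam mu nu k \<le> upper_bd n lam mu nu k"
proof -
  let ?T = "\<Sum>m=k+1..n-1. nu m"
  have lam: "lam j \<le> lam i" and mu: "mu j \<le> mu i" if "1 \<le> i" "i \<le> j" "j \<le> n" for i j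
    using maj that unfolding majorizes_def by (auto elim: monotone_onD)
  have tails: "(\<Sum>m=l..n. lam m) \<le> (\<Sum>m=l..n. mu m)" if "l \<in> {1..n}" for l
    using maj that unfolding majorizes_iff_tail_sums by blast
  have mu_last: "(\<Sum>m=l..n. mu m) = (\<Sum>m=l..n-1. mu m) + mu n" if "l \<in> {1..k}" for l
    using sum_split_last[of n l mu] that k by auto
  have lam_first: "(\<Sum>m=k..n. lam m) = lam k + (\<Sum>m=k+1..n. lam m)"
    using sum_split_first[of k n lam] k by auto

  have tail_ge: "(\<Sum>m=k+1..n. lam m) - mu n \<le> ?T"
  proof (cases "k + 1 \<le> n - 1")
    case True
    then have k1: "k + 1 \<in> {1..n-1}" by simp
    from bounds[OF True] show ?thesis unfolding mem_bounds_iff[OF k1] by simp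
  next
    case False
    then have "k + 1 = n" using k by auto
    then show ?thesis using tails[of n] by auto
  qed

  have tail_le: "lam (k + 1) + ?T + (\<Sum>m=l+1..k. lam m) \<le> (\<Sum>m=l..n-1. mu m)"
    if l: "l \<in> {1..k}" for l
  proof -
    have lam_last: "(\<Sum>m=l+1..k+1. lam m) = (\<Sum>m=l+1..k. lam m) + lam (k + 1)"
      using sum_split_at[of "l + 1" k "k + 1" lam] l by simp
    show ?thesis
    proof (cases "k + 1 \<le> n - 1")
      case True
      then have k1: "k + 1 \<in> {1..n-1}" by simp
      have "l \<in> {1..k+1}" using l by simp
      then have "?T + (\<Sum>m=l+1..k+1. lam m) \<le> (\<Sum>m=l..n-1. mu m)"
        using bounds[OF True] unfolding mem_bounds_iff[OF k1] by blast
      then show ?thesis using lam_last by linarith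
    next
      case False
      then have n: "n = k + 1" using k by auto
      have "(\<Sum>m=l+1..n. lam m) \<le> (\<Sum>m=l+1..n. mu m)"
        using tails[of "l + 1"] l n by auto
      moreover have "(\<Sum>m=l..n. mu m) = mu l + (\<Sum>m=l+1..n. mu m)"
        using sum_split_first[of l n mu] l n by simp
      moreover have "mu n \<le> mu l" using mu l n by auto
      moreover have "?T = 0" using n by simp
      ultimately show ?thesis using mu_last[OF l] lam_last n by simp
    qed
  qed

  have lower_le: "(\<Sum>m=k..n. lam m) - mu n + (\<Sum>m=l+1..k. lam m) \<le> (\<Sum>m=l..n-1. mu m)"
    if l: "l \<in> {1..k}" for l
  proof -
    \<comment> \<open>The two sums over \<open>lam\<close> together are the tail of \<open>lam\<close> at \<open>l\<close> with \<open>lam k\<close> in place of \<open>lam l\<close>.\<close>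
    have "(\<Sum>m=l+1..n. lam m) = (\<Sum>m=l+1..k. lam m) + (\<Sum>m=k+1..n. lam m)"
      using sum_split_at[of "l + 1" k n lam] l k by auto
    moreover have "(\<Sum>m=l..n. lam m) = lam l + (\<Sum>m=l+1..n. lam m)"
      using sum_split_first[of l n lam] l k by auto
    moreover have "lam k \<le> lam l" using lam l k by auto
    moreover have "(\<Sum>m=l..n. lam m) \<le> (\<Sum>m=l..n. mu m)" using tails l k by auto
    ultimately show ?thesis using lam_first mu_last[OF l] by linarith
  qed

  have le_iff: "lower_bd n lam mu nu k \<le> x \<longleftrightarrow>
      lam (k + 1) \<le> x \<and> (\<Sum>m=k..n. lam m) - mu n \<le> x + ?T" for x
    by (rule lower_bd_le_iff)
  have "lower_bd n lam mu nu k \<le> lam k"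
    unfolding le_iff using lam[of k "k + 1"] k lam_first tail_ge by auto
  moreover have "lower_bd n lam mu nu k \<le> (\<Sum>m=l..n-1. mu m) - ?T - (\<Sum>m=l+1..k. lam m)"
    if l: "l \<in> {1..k}" for l
    unfolding le_iff using tail_le[OF l] lower_le[OF l] by linarith
  moreover have "1 \<le> k" using k by simp
  ultimately show ?thesis
    unfolding le_upper_bd_iff[OF \<open>1 \<le> k\<close>] by (fastforce simp: algebra_simps)
qed

theorem theorem4p1:
  fixes n :: nat and lam mu nu :: "nat \<Rightarrow> real"
  assumes "n \<ge> 2"
    and "antimono_on {1..n} lam"
    and "antimono_on {1..n} mu"
    and "majorizes n lam mu"
  shows "((majorizes (n - 1) nu mu \<and> interlaces n nu lam) \<longleftrightarrow>
           (\<forall>k\<in>{1..n-1}. nu k \<in> {lower_bd n lam mu nu k..upper_bd n lam mu nu k})) \<and>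
         (\<forall>k\<in>{1..n-1}.
           (\<forall>j\<in>{k+1..n-1}. nu j \<in> {lower_bd n lam mu nu j..upper_bd n lam mu nu j}) \<longrightarrow>
             lower_bd n lam mu nu k \<le> upper_bd n lam mu nu k \<and>
             (\<exists>x. \<forall>j\<in>{k..n-1}.
                (nu(k := x)) j \<in> {lower_bd n lam mu (nu(k := x)) j..upper_bd n lam mu (nu(k := x)) j}))"
proof (intro conjI ballI impI)
  have total: "(\<Sum>m=1..n. lam m) = (\<Sum>m=1..n. mu m)"
    using assms(4) unfolding majorizes_def by blast
  show "(majorizes (n - 1) nu mu \<and> interlaces n nu lam) \<longleftrightarrow>
      (\<forall>k\<in>{1..n-1}. nu k \<in> {lower_bd n lam mu nu k..upper_bd n lam mu nu k})"
    using majorizes_interlaces_imp_mem_bounds[OF total]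
      mem_bounds_imp_majorizes_interlaces[OF assms(1,3) total] by blast
next
  fix k
  assume k: "k \<in> {1..n-1}"
    and bounds: "\<forall>j\<in>{k+1..n-1}. nu j \<in> {lower_bd n lam mu nu j..upper_bd n lam mu nu j}"
  show le: "lower_bd n lam mu nu k \<le> upper_bd n lam mu nu k"
    using bounds by (intro lower_bd_le_upper_bd[OF assms(4) k]) auto
  define nu' where "nu' = nu(k := lower_bd n lam mu nu k)"
  have "nu' j \<in> {lower_bd n lam mu nu' j..upper_bd n lam mu nu' j}" if j: "j \<in> {k..n-1}" for j
  proof -
    have "lower_bd n lam mu nu' j = lower_bd n lam mu nu j"
      and "upper_bd n lam mu nu' j = upper_bd n lam mu nu j"
      using j by (auto intro!: bounds_cong simp: nu'_def)
    then show ?thesis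
      using le bounds j by (cases "j = k") (auto simp: nu'_def)
  qed
  then show "\<exists>x. \<forall>j\<in>{k..n-1}.
      (nu(k := x)) j \<in> {lower_bd n lam mu (nu(k := x)) j..upper_bd n lam mu (nu(k := x)) j}"
    unfolding nu'_def by blast
qed

end
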